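(* Let $S,O$ be sets, $\iota_S:S\to(0,\infty)$, $\iota_O:O\to(0,\infty)$ maps, $c(s,o):=J(\iota_S(s)/\iota_O(o))$, and let $\mathcal C:S\times O\to\mathbb{R}$ be a certificate that is ordinally sound relative to $c$. Fix $s\in S$, put $r(o):=\iota_S(s)/\iota_O(o)$, and suppose there are $0<a\le b<\infty$ with $r(o)\in[a,b]$ for all $o\in O$. Let $\delta\ge0$ and let $\widehat r:O\to(0,\infty)$ (estimates of the ratios obtained from $K$ windowed measurements) satisfy $|\widehat r(o)/r(o)-1|\le\delta$ for all $o\in O$. Set $$\varepsilon:=L(a)\,\delta\,b,\qquad L(a):=\tfrac12\bigl(1+a^{-2}\bigr).$$ Then every minimizer $\widehat o\in O$ of the perturbed cost $\widehat c(o):=J(\widehat r(o))$ over $O$ belongs to $\mathrm{Mean}_{2\varepsilon}(s)$. In particular $\varepsilon=\varepsilon(\delta)\to0$ as $\delta\to0$ for fixed $a,b$.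
   Context: $J(x):=\frac12(x+x^{-1})-1$ for $x>0$. For $\eta\ge0$, $$\mathrm{Mean}_\eta(s):=\{o\in O:\ c(s,o)\le\inf_{o'\in O}c(s,o')+\eta\}.$$ A certificate $\mathcal C:S\times O\to\mathbb{R}$ is ordinally sound relative to $c$ if for every $s\in S$ and all $o_1,o_2\in O$: $\mathcal C(s,o_1)\le\mathcal C(s,o_2)\iff c(s,o_1)\le c(s,o_2)$. It is assumed throughout that the minimizer sets $\arg\min_{o\in O}c(s,o)$ are nonempty. *)

theory Defs
  imports Complex_Main
begin

definition J :: "real \<Rightarrow> real" where
  "J x = (1/2) * (x + inverse x) - 1"

definition ratio_cost :: "('s \<Rightarrow> real) \<Rightarrow> ('o \<Rightarrow> real) \<Rightarrow> 's \<Rightarrow> 'o \<Rightarrow> real" where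
  "ratio_cost \<iota>S \<iota>O s x = J (\<iota>S s / \<iota>O x)"

definition minimizers :: "('o \<Rightarrow> real) \<Rightarrow> 'o set \<Rightarrow> 'o set" where
  "minimizers f Obj = {x. is_arg_min f (\<lambda>y. y \<in> Obj) x}"

(* The infimum is the conditionally complete one on the reals: it is meaningful when Obj is
   nonempty and c s is bounded below on Obj, as it is when c s has a minimizer on Obj. *)
definition Mean :: "'o set \<Rightarrow> ('s \<Rightarrow> 'o \<Rightarrow> real) \<Rightarrow> real \<Rightarrow> 's \<Rightarrow> 'o set" where
  "Mean Obj c \<eta> s = {x \<in> Obj. c s x \<le> (INF y\<in>Obj. c s y) + \<eta>}"

definition ordinally_sound ::
  "'s set \<Rightarrow> 'o set \<Rightarrow> ('s \<Rightarrow> 'o \<Rightarrow> real) \<Rightarrow> ('s \<Rightarrow> 'o \<Rightarrow> real) \<Rightarrow> bool" where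
  "ordinally_sound S Obj C c \<longleftrightarrow>
     (\<forall>s\<in>S. \<forall>x\<in>Obj. \<forall>y\<in>Obj. C s x \<le> C s y \<longleftrightarrow> c s x \<le> c s y)"

definition L :: "real \<Rightarrow> real" where
  "L a = (1/2) * (1 + inverse (a\<^sup>2))"

definition err :: "real \<Rightarrow> real \<Rightarrow> real \<Rightarrow> real" where
  "err a b \<delta> = L a * \<delta> * b"

end

theory Submission imports Defs begin

text \<open>
  The obvious argument bounds \<open>\<bar>J (rhat x) - J (r x)\<bar>\<close> by \<open>err a b \<delta>\<close>, because \<open>J\<close> has
  Lipschitz constant \<open>L a\<close> on \<open>[a, \<infinity>)\<close>, and adds two such errors. It breaks down here: only the
  true ratios lie in \<open>[a, b]\<close>. An estimate may lie below \<open>a\<close>, even arbitrarily close to \<open>0\<close>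
  when \<open>\<delta> \<ge> 1\<close>, where \<open>J\<close> is much steeper the pointwise bound can fail..

  The proof therefore compares ratios rather than costs. Since \<open>J\<close> is invariant under inversion and
  increases on \<open>[1, \<infinity>)\<close>, the order of costs is the order of the imbalances
  \<open>m x = max x (1 / x) = exp \<bar>ln x\<bar>\<close>, and a relative error of at most \<open>\<delta> \<le> 1\<close> in \<open>x\<close> changes \<open>m x\<close> by
  a factor of at least \<open>1 - \<delta>\<close> in either direction (lemma \<open>imbalance_perturb\<close>). If the estimate
  of \<open>x\<close> costs no more than that of \<open>y\<close>, two such changes give
  \<open>(1 - \<delta>)\<^sup>2 * m x \<le> m y\<close> for the true ratios, hence \<open>m x - m y \<le> 2 * \<delta> * m x\<close>, which is trivial
  for \<open>\<delta> \<ge> 1\<close>. As \<open>J\<close> has slope at most \<open>1/2\<close> on \<open>[1, \<infinity>)\<close>, the true costs differ by at most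
  \<open>\<delta> * m x\<close> (lemma \<open>J_diff_le_of_perturbed_le\<close>). Finally
  \<open>m x \<le> b + 1 / a \<le> b * (1 + 1 / a\<^sup>2) = 2 * L a * b\<close>, so the difference is at most \<open>2 * err a b \<delta>\<close>.
\<close>

definition imbalance :: "real \<Rightarrow> real" where
  "imbalance x = max x (inverse x)"

lemma imbalance_ge_1:
  assumes "0 < x"
  shows "1 \<le> imbalance x"
  using assms one_le_inverse[of x] by (cases "x \<le> 1") (auto simp: imbalance_def le_max_iff_disj)

lemma J_imbalance: "J (imbalance x) = J x"
  by (simp add: J_def imbalance_def max_def)

lemma J_diff:
  assumes "0 < x" "0 < y"
  shows "J x - J y = (x - y) * (1 - inverse (x * y)) / 2"
  using assms by (simp add: J_def field_simps)

lemma J_strict_mono: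
  assumes "1 \<le> y" "y < x"
  shows "J y < J x"
proof -
  have "1 < x * y"
    using assms by (metis less_le_trans le_less_trans less_1_mult mult.right_neutral order_le_less)
  then have "0 < (x - y) * (1 - inverse (x * y))"
    using assms inverse_less_1_iff[of "x * y"] by simp
  then show ?thesis
    using J_diff[of x y] assms by simp
qed

lemma J_diff_le_half:
  assumes "1 \<le> y" "y \<le> x"
  shows "J x - J y \<le> (x - y) / 2"
proof -
  have "(x - y) * (1 - inverse (x * y)) \<le> (x - y) * 1"
    using assms by (intro mult_left_mono) auto
  then show ?thesis
    using J_diff[of x y] assms by simp
qed

lemma imbalance_le_iff_J_le:
  assumes "0 < x" "0 < y"
  shows "imbalance x \<le> imbalance y \<longleftrightarrow> J x \<le> J y"
  using J_strict_mono[of "imbalance x" "imbalance y"] J_strict_mono[of "imbalance y" "imbalance x"]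
    J_imbalance[of x] J_imbalance[of y]
    imbalance_ge_1[OF assms(1)] imbalance_ge_1[OF assms(2)]
  by (cases "imbalance x" "imbalance y" rule: linorder_cases) auto

text \<open>
  The factors \<open>1 - \<delta>\<close> and \<open>1 + \<delta>\<close> act on \<open>x\<close> and \<open>1 / x\<close> in opposite ways; the single
  constant \<open>1 - \<delta>\<close> serves for all four comparisons because \<open>(1 - \<delta>) * (1 + \<delta>) \<le> 1\<close>.
\<close>

lemma imbalance_perturb:
  assumes x: "0 < x" and y: "0 < y" and \<delta>: "\<delta> \<le> 1" and close: "\<bar>y / x - 1\<bar> \<le> \<delta>"
  shows "(1 - \<delta>) * imbalance x \<le> imbalance y" "(1 - \<delta>) * imbalance y \<le> imbalance x"
proof -
  have lower: "(1 - \<delta>) * x \<le> y" and upper: "y \<le> (1 + \<delta>) * x"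
    using close x by (auto simp: abs_le_iff field_simps)
  have "(1 - \<delta>) * y \<le> (1 - \<delta>) * ((1 + \<delta>) * x)"
    using upper \<delta> by (intro mult_left_mono) auto
  also have "\<dots> = x - \<delta>\<^sup>2 * x"
    by (simp add: algebra_simps power2_eq_square)
  also have "\<dots> \<le> x"
    using x by simp
  finally have swapped: "(1 - \<delta>) * y \<le> x" .
  have "(1 - \<delta>) * inverse x \<le> inverse y" "(1 - \<delta>) * inverse y \<le> inverse x"
    using lower swapped x y by (simp_all add: field_simps)
  then show "(1 - \<delta>) * imbalance x \<le> imbalance y" "(1 - \<delta>) * imbalance y \<le> imbalance x"
    using lower swapped \<delta> by (auto simp: imbalance_def max_mult_distrib_left le_max_iff_disj)
qed

lemma J_diff_le_of_perturbed_le: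
  assumes x: "0 < x" "0 < x'" "\<bar>x' / x - 1\<bar> \<le> \<delta>"
    and y: "0 < y" "0 < y'" "\<bar>y' / y - 1\<bar> \<le> \<delta>"
    and le: "J x' \<le> J y'"
  shows "J x - J y \<le> \<delta> * imbalance x"
proof -
  let ?m = "imbalance x" and ?n = "imbalance y"
  have m: "1 \<le> ?m" and n: "1 \<le> ?n"
    using imbalance_ge_1 x y by auto
  have \<delta>: "0 \<le> \<delta>"
    using x(3) by linarith
  have gap: "?m - ?n \<le> 2 * (\<delta> * ?m)"
  proof (cases "\<delta> \<le> 1")
    case True
    have "(1 - \<delta>) * ((1 - \<delta>) * ?m) \<le> (1 - \<delta>) * imbalance x'"
      using imbalance_perturb(1)[OF x(1,2) True x(3)] True by (intro mult_left_mono) auto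
    also have "\<dots> \<le> (1 - \<delta>) * imbalance y'"
      using imbalance_le_iff_J_le[OF x(2) y(2)] le True by (intro mult_left_mono) auto
    also have "\<dots> \<le> ?n"
      by (rule imbalance_perturb(2)[OF y(1,2) True y(3)])
    finally have "?m - 2 * (\<delta> * ?m) + \<delta>\<^sup>2 * ?m \<le> ?n"
      by (simp add: algebra_simps power2_eq_square)
    moreover have "0 \<le> \<delta>\<^sup>2 * ?m"
      using m by simp
    ultimately show ?thesis
      by linarith
  next
    case False
    then have "1 * ?m \<le> \<delta> * ?m"
      using m by (intro mult_right_mono) auto
    then show ?thesis
      using m n by linarith
  qed
  have "J ?m - J ?n \<le> \<delta> * ?m"
  proof (cases "?n \<le> ?m")
    case True
    then show ?thesis
      using J_diff_le_half[OF n True] gap by (simp add: field_simps)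
  next
    case False
    then have "J ?m < J ?n"
      using J_strict_mono m by simp
    moreover have "0 \<le> \<delta> * ?m"
      using \<delta> m by simp
    ultimately show ?thesis
      by linarith
  qed
  then show ?thesis
    by (simp add: J_imbalance)
qed

lemma imbalance_le_2_L:
  assumes "0 < a" "a \<le> x" "x \<le> b"
  shows "imbalance x \<le> 2 * L a * b"
proof -
  have "inverse x \<le> inverse a"
    using assms by (intro le_imp_inverse_le) auto
  also have "\<dots> = inverse (a\<^sup>2) * a"
    using assms by (simp add: power2_eq_square)
  also have "\<dots> \<le> inverse (a\<^sup>2) * b"
    using assms by (intro mult_left_mono) auto
  finally have inv: "inverse x \<le> inverse (a\<^sup>2) * b" .
  have "0 < inverse (a\<^sup>2) * b"
    using assms by simp
  then have "imbalance x \<le> b + inverse (a\<^sup>2) * b"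
    using inv assms unfolding imbalance_def by linarith
  then show ?thesis
    by (simp add: L_def algebra_simps)
qed

lemma err_tendsto_0: "(err a b \<longlongrightarrow> 0) (at 0 within A)"
proof -
  have "((\<lambda>d. L a * d * b) \<longlongrightarrow> L a * 0 * b) (at 0 within A)"
    by (intro tendsto_intros)
  then show ?thesis
    by (simp add: err_def[abs_def])
qed

theorem theorem3p36:
  fixes S :: "'s set" and Obj :: "'o set"
    and \<iota>S :: "'s \<Rightarrow> real" and \<iota>O :: "'o \<Rightarrow> real"
    and C :: "'s \<Rightarrow> 'o \<Rightarrow> real"
    and s :: 's and a b \<delta> :: real and rhat :: "'o \<Rightarrow> real"
  assumes "\<forall>t\<in>S. \<iota>S t > 0"
    and "\<forall>x\<in>Obj. \<iota>O x > 0"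
    and "\<forall>t\<in>S. minimizers (ratio_cost \<iota>S \<iota>O t) Obj \<noteq> {}"
    and "ordinally_sound S Obj C (ratio_cost \<iota>S \<iota>O)"
    and "s \<in> S"
    and "0 < a" and "a \<le> b"
    and "\<forall>x\<in>Obj. \<iota>S s / \<iota>O x \<in> {a..b}"
    and "\<delta> \<ge> 0"
    and "\<forall>x\<in>Obj. rhat x > 0"
    and "\<forall>x\<in>Obj. \<bar>rhat x / (\<iota>S s / \<iota>O x) - 1\<bar> \<le> \<delta>"
  shows "minimizers (\<lambda>x. J (rhat x)) Obj \<subseteq> Mean Obj (ratio_cost \<iota>S \<iota>O) (2 * err a b \<delta>) s
    \<and> ((\<lambda>d. err a b d) \<longlongrightarrow> 0) (at 0 within {0..})"
proof
  let ?r = "\<lambda>x. \<iota>S s / \<iota>O x"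
  show "minimizers (\<lambda>x. J (rhat x)) Obj \<subseteq> Mean Obj (ratio_cost \<iota>S \<iota>O) (2 * err a b \<delta>) s"
  proof
    fix x assume "x \<in> minimizers (\<lambda>x. J (rhat x)) Obj"
    then have x: "x \<in> Obj" and min: "\<And>y. y \<in> Obj \<Longrightarrow> J (rhat x) \<le> J (rhat y)"
      by (auto simp: minimizers_def is_arg_min_def not_less)
    have pos: "0 < ?r y" if "y \<in> Obj" for y
      using assms(1,2,5) that by simp
    have "J (?r x) - 2 * err a b \<delta> \<le> J (?r y)" if y: "y \<in> Obj" for y
    proof -
      have "J (?r x) - J (?r y) \<le> \<delta> * imbalance (?r x)"
        using J_diff_le_of_perturbed_le[of "?r x" "rhat x" \<delta> "?r y" "rhat y"]
          pos min[OF y] x y assms(10,11) by blast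
      also have "\<dots> \<le> \<delta> * (2 * L a * b)"
        using imbalance_le_2_L[of a "?r x" b] assms(6,8,9) x by (intro mult_left_mono) auto
      also have "\<dots> = 2 * err a b \<delta>"
        by (simp add: err_def)
      finally show ?thesis
        by linarith
    qed
    then have "J (?r x) - 2 * err a b \<delta> \<le> (INF y\<in>Obj. J (?r y))"
      using x by (intro cINF_greatest) auto
    then show "x \<in> Mean Obj (ratio_cost \<iota>S \<iota>O) (2 * err a b \<delta>) s"
      using x by (simp add: Mean_def ratio_cost_def)
  qed
  show "((\<lambda>d. err a b d) \<longlongrightarrow> 0) (at 0 within {0..})"
    by (rule err_tendsto_0)
qed

end
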